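(* Let $G$ be a finite group acting on a finite nonempty set $X$, let $K$ be the classical Burnside kernel on $X$ and $Q$ the dual Burnside kernel on $G^*$. Then $K$ and $Q$ have the same nonzero eigenvalues, $$\mathrm{Spec}_{\neq0}(K)=\mathrm{Spec}_{\neq0}(Q),$$ with matching algebraic multiplicities. Moreover, the nonsingular parts of their Jordan forms (the Jordan blocks with nonzero eigenvalue) coincide.
   Context: For $g\in G$ and $x\in X$ write $X_g:=\{x\in X: g\cdot x=x\}$, $G_x:=\{g\in G: g\cdot x=x\}$, and $G^*:=\{g\in G: X_g\neq\varnothing\}$. The classical Burnside kernel is the $X\times X$ matrix $$K(x,y)=\frac1{|G_x|}\sum_{g\in G_x\cap G_y}\frac1{|X_g|},$$ and the dual Burnside kernel is the $G^*\times G^*$ matrix $$Q(g,h)=\frac1{|X_g|}\sum_{x\in X_g\cap X_h}\frac1{|G_x|}.$$ $\mathrm{Spec}_{\neq0}(P)$ denotes the nonzero eigenvalues of the matrix $P$. *)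

theory Defs
  imports
    "HOL-Algebra.Group_Action"
    "Jordan_Normal_Form.Jordan_Normal_Form_Uniqueness"
    "Jordan_Normal_Form.Spectral_Radius"
begin

text \<open>
  For an action \<open>\<phi>\<close> of \<open>G\<close> on \<open>X\<close> (locale \<^locale>\<open>group_action\<close>),
  \<open>X\<^sub>g\<close> is \<open>invariants X \<phi> g\<close> and \<open>G\<^sub>x\<close> is \<open>stabilizer G \<phi> x\<close>; the set \<open>G\<^sup>*\<close> is the following.
\<close>

definition fixing_elements :: "('g, 'm) monoid_scheme \<Rightarrow> 'x set \<Rightarrow> ('g \<Rightarrow> 'x \<Rightarrow> 'x) \<Rightarrow> 'g set" where
  "fixing_elements G X \<phi> = {g \<in> carrier G. invariants X \<phi> g \<noteq> {}}"

definition burnside_kernel ::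
    "('g, 'm) monoid_scheme \<Rightarrow> 'x set \<Rightarrow> ('g \<Rightarrow> 'x \<Rightarrow> 'x) \<Rightarrow> 'x \<Rightarrow> 'x \<Rightarrow> real" where
  "burnside_kernel G X \<phi> x y =
     1 / real (card (stabilizer G \<phi> x)) *
       (\<Sum>g \<in> stabilizer G \<phi> x \<inter> stabilizer G \<phi> y. 1 / real (card (invariants X \<phi> g)))"

definition dual_burnside_kernel ::
    "('g, 'm) monoid_scheme \<Rightarrow> 'x set \<Rightarrow> ('g \<Rightarrow> 'x \<Rightarrow> 'x) \<Rightarrow> 'g \<Rightarrow> 'g \<Rightarrow> real" where
  "dual_burnside_kernel G X \<phi> g h =
     1 / real (card (invariants X \<phi> g)) *
       (\<Sum>x \<in> invariants X \<phi> g \<inter> invariants X \<phi> h. 1 / real (card (stabilizer G \<phi> x)))"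

text \<open>
  A matrix indexed by a finite set \<open>S\<close> is represented with respect to an enumeration of \<open>S\<close>,
  that is, a list \<open>xs\<close> with \<open>distinct xs\<close> and \<open>set xs = S\<close>. The entries are regarded as
  complex numbers, so that eigenvalues and Jordan forms are taken over the complex field.
\<close>

definition kernel_matrix :: "'a list \<Rightarrow> ('a \<Rightarrow> 'a \<Rightarrow> real) \<Rightarrow> complex mat" where
  "kernel_matrix xs k =
     mat (length xs) (length xs) (\<lambda>(i, j). complex_of_real (k (xs ! i) (xs ! j)))"

definition nonzero_spectrum :: "complex mat \<Rightarrow> complex set" where
  "nonzero_spectrum A = spectrum A - {0}"

text \<open>
  A Jordan form is given by its list of blocks \<open>(size, eigenvalue)\<close>, see \<^const>\<open>jordan_nf\<close>.
  It is unique only up to the order of the blocks, hence the multiset.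
\<close>

definition nonsingular_blocks :: "(nat \<times> complex) list \<Rightarrow> (nat \<times> complex) multiset" where
  "nonsingular_blocks js = mset (filter (\<lambda>(n, a). a \<noteq> 0) js)"

end

theory Submission
  imports Defs
begin

text \<open>
  Let \<open>A(x, g) = 1 / |G\<^sub>x|\<close> if \<open>g\<close> fixes \<open>x\<close> and \<open>0\<close> otherwise, and let \<open>B(g, x) = 1 / |X\<^sub>g|\<close> if \<open>g\<close>
  fixes \<open>x\<close> and \<open>0\<close> otherwise. Then \<open>K = AB\<close> and \<open>Q = BA\<close>. For \<open>e \<noteq> 0\<close> multiplication by \<open>B\<close> embeds
  the kernel of \<open>(AB - e)\<^sup>k\<close> into that of \<open>(BA - e)\<^sup>k\<close>, and \<open>A\<close> gives an embedding in the other
  direction. So the two kernels have equal dimension for all \<open>k\<close>, and these dimensions determine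
  the Jordan blocks with eigenvalue \<open>e\<close>.
\<close>

text \<open>A basis of the kernel of \<open>M\<close> is sent injectively to a linearly independent
  family in the kernel of \<open>N\<close>, which bounds its size by the dimension there. The two
  kernels may lie in spaces of different dimension.\<close>

lemma kernel_dim_le_if_inj:
  fixes M N B :: "'a :: field mat"
  assumes M: "M \<in> carrier_mat r n" and N: "N \<in> carrier_mat s m" and B: "B \<in> carrier_mat m n"
    and maps: "\<And>v. v \<in> mat_kernel M \<Longrightarrow> B *\<^sub>v v \<in> mat_kernel N"
    and inj: "\<And>v. v \<in> mat_kernel M \<Longrightarrow> B *\<^sub>v v = 0\<^sub>v m \<Longrightarrow> v = 0\<^sub>v n"
  shows "kernel_dim M \<le> kernel_dim N"
proof -
  interpret M: kernel r n M by (unfold_locales, rule M)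
  interpret N: kernel s m N by (unfold_locales, rule N)
  have carr: "v \<in> carrier_vec n" if "v \<in> mat_kernel M" for v
    using mat_kernelD(1)[OF M that] .
  have lm: "linear_map class_ring M.VK N.VK ((*\<^sub>v) B)"
    unfolding linear_map_def mod_hom_def mod_hom_axioms_def module_hom_def
    using M.Ker.vectorspace_axioms N.Ker.vectorspace_axioms
      M.Ker.module_axioms N.Ker.module_axioms
    by (auto simp: maps carr mult_add_distrib_mat_vec[OF B] mult_mat_vec[OF B] module_vec_simps)
  interpret T: linear_map class_ring M.VK N.VK "(*\<^sub>v) B" by (rule lm)
  have finN: "N.Ker.fin_dim"
    using kernel_basis_exists[OF N] unfolding N.Ker.basis_def N.Ker.fin_dim_def by auto
  have "B *\<^sub>v 0\<^sub>v n = 0\<^sub>v m" and "M *\<^sub>v 0\<^sub>v n = 0\<^sub>v r"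
    using B M by (auto simp: scalar_prod_def)
  then have "{v \<in> mat_kernel M. B *\<^sub>v v = 0\<^sub>v m} = {0\<^sub>v n}"
    using inj mat_kernelI[OF M zero_carrier_vec] by auto
  then have inj_on: "inj_on ((*\<^sub>v) B) (mat_kernel M)"
    using T.Ke0_imp_inj by (simp add: T.ker_def)
  obtain b where b: "finite b" "M.basis b"
    using kernel_basis_exists[OF M] by blast
  then have sub: "b \<subseteq> mat_kernel M" and indep: "M.lin_indpt b"
    unfolding M.Ker.basis_def by auto
  have image: "(*\<^sub>v) B ` b \<subseteq> mat_kernel N" using sub maps by auto
  have card: "card ((*\<^sub>v) B ` b) = card b"
    using inj_on_subset[OF inj_on sub] by (rule card_image)
  \<comment> \<open>A vanishing combination of the images with coefficients \<open>a\<close> is the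
    image of the combination of \<open>b\<close> with coefficients \<open>a\<close> composed with
    \<open>B\<close>. By \<open>inj\<close> the latter already vanishes, and independence of
    \<open>b\<close> applies.\<close>
  have indepN: "N.lin_indpt ((*\<^sub>v) B ` b)"
  proof (rule N.Ker.finite_lin_indpt2)
    fix a
    assume "N.lincomb a ((*\<^sub>v) B ` b) = 0\<^sub>v m"
    then have "B *\<^sub>v M.lincomb (a \<circ> (*\<^sub>v) B) b = 0\<^sub>v m"
      using T.lincomb_linear_image[of b a] inj_on sub b(1) by simp
    moreover have "M.lincomb (a \<circ> (*\<^sub>v) B) b \<in> mat_kernel M"
      using M.Ker.lincomb_closed[OF sub] by simp
    ultimately have "M.lincomb (a \<circ> (*\<^sub>v) B) b = 0\<^sub>v n"
      using inj by blast
    then have "a \<circ> (*\<^sub>v) B \<in> b \<rightarrow> {0}"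
      using M.Ker.not_lindepD[OF indep b(1) order_refl] by simp
    then show "\<forall>v\<in>(*\<^sub>v) B ` b. a v = 0" by auto
  qed (use b image in auto)
  have "card b \<le> N.dim"
    using N.Ker.li_le_dim(2)[OF finN _ indepN] image card by simp
  then have "M.dim \<le> N.dim"
    using M.Ker.dim_basis[OF b] by simp
  then show ?thesis by simp
qed

text \<open>Both B(AB - e) and (BA - e)B equal BAB - eB. Induction then moves \<open>B\<close> past
  one factor at a time.\<close>

lemma char_matrix_pow_intertwine:
  fixes A B :: "'a :: field mat"
  assumes A: "A \<in> carrier_mat m n" and B: "B \<in> carrier_mat n m"
  shows "B * char_matrix (A * B) e ^\<^sub>m k = char_matrix (B * A) e ^\<^sub>m k * B"
proof (induct k)
  case 0
  show ?case using A B by (simp add: char_matrix_def)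
next
  case (Suc k)
  let ?C = "char_matrix (A * B) e" and ?D = "char_matrix (B * A) e"
  have C: "?C \<in> carrier_mat m m" and D: "?D \<in> carrier_mat n n"
    using A B by auto
  note Ck = pow_carrier_mat[OF C, of k] and Dk = pow_carrier_mat[OF D, of k]
  have "B * ?C = B * (A * B) + B * ((- e) \<cdot>\<^sub>m 1\<^sub>m m)"
    unfolding char_matrix_def using A B by (simp add: mult_add_distrib_mat[of _ n m _ m])
  also have "\<dots> = B * A * B + ((- e) \<cdot>\<^sub>m 1\<^sub>m n) * B"
    using A B by (simp add: mult_smult_distrib[OF B one_carrier_mat] mult_smult_assoc_mat[of _ n n _ m]
          assoc_mult_mat[of _ n m _ n])
  also have "\<dots> = ?D * B"
    unfolding char_matrix_def using A B by (simp add: add_mult_distrib_mat[of _ n n _ _ m])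
  finally have step: "B * ?C = ?D * B" .
  have "B * ?C ^\<^sub>m Suc k = B * ?C ^\<^sub>m k * ?C"
    using assoc_mult_mat[OF B Ck C] by simp
  also have "\<dots> = ?D ^\<^sub>m k * (B * ?C)"
    unfolding Suc using assoc_mult_mat[OF Dk B C] by simp
  also have "\<dots> = ?D ^\<^sub>m Suc k * B"
    unfolding step using assoc_mult_mat[OF Dk D B] by simp
  finally show ?case .
qed

text \<open>Intertwining shows that \<open>B\<close> maps one generalized eigenspace into the other.
  It is injective there because AB - e acts as the nonzero scalar -e on every vector that
  \<open>B\<close> kills, so no power of AB - e can annihilate such a vector unless it is
  zero.\<close>

lemma dim_gen_eigenspace_mult_le:
  fixes A B :: "'a :: field mat"
  assumes A: "A \<in> carrier_mat m n" and B: "B \<in> carrier_mat n m" and e: "e \<noteq> 0"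
  shows "dim_gen_eigenspace (A * B) e k \<le> dim_gen_eigenspace (B * A) e k"
proof -
  let ?C = "char_matrix (A * B) e" and ?D = "char_matrix (B * A) e"
  have AB: "A * B \<in> carrier_mat m m" using A B by auto
  have C: "?C \<in> carrier_mat m m" and D: "?D \<in> carrier_mat n n"
    using A B by auto
  note Ck = pow_carrier_mat[OF C, of k] and Dk = pow_carrier_mat[OF D, of k]
  show ?thesis
    unfolding dim_gen_eigenspace_def
  proof (rule kernel_dim_le_if_inj[OF Ck Dk B])
    fix v
    assume "v \<in> mat_kernel (?C ^\<^sub>m k)"
    from mat_kernelD[OF Ck this] have v: "v \<in> carrier_vec m" and 0: "?C ^\<^sub>m k *\<^sub>v v = 0\<^sub>v m" .
    have "?D ^\<^sub>m k *\<^sub>v (B *\<^sub>v v) = B *\<^sub>v (?C ^\<^sub>m k *\<^sub>v v)"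
      using assoc_mult_mat_vec[OF Dk B v] assoc_mult_mat_vec[OF B Ck v]
        char_matrix_pow_intertwine[OF A B, of e k] by simp
    then show "B *\<^sub>v v \<in> mat_kernel (?D ^\<^sub>m k)"
      using B v by (intro mat_kernelI[OF Dk]) (auto simp: 0)
    assume Bv: "B *\<^sub>v v = 0\<^sub>v n"
    show "v = 0\<^sub>v m"
    proof (rule ccontr)
      assume nz: "v \<noteq> 0\<^sub>v m"
      have "A * B *\<^sub>v v = 0\<^sub>v m"
        using assoc_mult_mat_vec[OF A B v] A by (auto simp: Bv)
      moreover have "(- e) \<cdot>\<^sub>m 1\<^sub>m m *\<^sub>v v = (- e) \<cdot>\<^sub>v v"
        using v by (intro eq_vecI) auto
      ultimately have "?C *\<^sub>v v = (- e) \<cdot>\<^sub>v v"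
        unfolding char_matrix_def using AB A v by (subst add_mult_distrib_mat_vec[of _ m m]) auto
      then have "eigenvector ?C v (- e)"
        unfolding eigenvector_def using C v nz by auto
      from eigenvector_pow[OF C this, of k] have "(- e) ^ k \<cdot>\<^sub>v v = 0\<^sub>v m"
        using 0 by simp
      then have "v = 0\<^sub>v m"
        using e v by (auto simp: vec_eq_iff)
      with nz show False ..
    qed
  qed
qed

lemma dim_gen_eigenspace_mult_commute:
  fixes A B :: "'a :: field mat"
  assumes "A \<in> carrier_mat m n" and "B \<in> carrier_mat n m" and "e \<noteq> 0"
  shows "dim_gen_eigenspace (A * B) e k = dim_gen_eigenspace (B * A) e k"
  using dim_gen_eigenspace_mult_le[OF assms] dim_gen_eigenspace_mult_le[OF assms(2,1,3)]
  by (rule antisym)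

text \<open>The number of blocks of size \<open>k\<close> for \<open>e\<close> is a second
  difference in \<open>k\<close> of the dimensions of the generalized eigenspaces.\<close>

lemma nonsingular_blocks_eq_if_dim_gen_eigenspace_eq:
  assumes "jordan_nf M js" and "jordan_nf N js'"
    and dim: "\<And>e k. e \<noteq> 0 \<Longrightarrow> dim_gen_eigenspace M e k = dim_gen_eigenspace N e k"
  shows "nonsingular_blocks js = nonsingular_blocks js'"
proof (rule multiset_eqI)
  \<comment> \<open>The counting formula is valid for positive sizes only. Size 0 never occurs in a
    Jordan form, and eigenvalue 0 is removed by the filter, so both counts are 0.\<close>
  have count: "count (nonsingular_blocks ks) (k, e) =
      (if e = 0 \<or> k = 0 then 0 else compute_nr_of_jordan_blocks L e k)"
    if "jordan_nf L ks" for L ks k e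
  proof (cases "e = 0 \<or> k = 0")
    case True
    with that have "(k, e) \<notin># nonsingular_blocks ks"
      unfolding nonsingular_blocks_def jordan_nf_def by force
    with True show ?thesis by (simp add: count_eq_zero_iff)
  next
    case False
    then have "count (nonsingular_blocks ks) (k, e) = length (filter ((=) (k, e)) ks)"
      unfolding nonsingular_blocks_def by (induct ks) auto
    with False show ?thesis using compute_nr_of_jordan_blocks[OF that] by simp
  qed
  fix b :: "nat \<times> complex"
  obtain k e where "b = (k, e)" by force
  then show "count (nonsingular_blocks js) b = count (nonsingular_blocks js') b"
    using count[OF assms(1)] count[OF assms(2)] dim
    by (simp add: compute_nr_of_jordan_blocks_def)
qed

text \<open>The algebraic multiplicity is the total size of the blocks for \<open>e\<close>, and for
  nonzero \<open>e\<close> all of them survive in \<open>nonsingular_blocks\<close>. Equal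
  multiplicities thus follow from equal blocks.\<close>

lemma jordan_nf_order_nonsingular_blocks:
  assumes "jordan_nf M js" and "e \<noteq> 0"
  shows "Polynomial.order e (char_poly M) =
    sum_mset (image_mset fst (filter_mset (\<lambda>b. snd b = e) (nonsingular_blocks js)))"
proof -
  have "filter (\<lambda>b. snd b = e) js = filter (\<lambda>b. snd b = e) (filter (\<lambda>(n, a). a \<noteq> 0) js)"
    using assms(2) by (auto simp: filter_filter intro!: filter_cong)
  then have "sum_list (map fst (filter (\<lambda>b. snd b = e) js)) =
      sum_mset (image_mset fst (filter_mset (\<lambda>b. snd b = e) (nonsingular_blocks js)))"
    unfolding nonsingular_blocks_def
    by (simp only: mset_filter[symmetric] mset_map[symmetric] sum_mset_sum_list)
  then show ?thesis using jordan_nf_order[OF assms(1)] by simp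
qed

lemma nonzero_spectrum_iff_order:
  assumes "M \<in> carrier_mat n n"
  shows "e \<in> nonzero_spectrum M \<longleftrightarrow> e \<noteq> 0 \<and> Polynomial.order e (char_poly M) \<noteq> 0"
proof -
  \<comment> \<open>A root has positive order only for a nonzero polynomial;
    \<open>char_poly M\<close> is monic.\<close>
  have "char_poly M \<noteq> 0" using degree_monic_char_poly[OF assms] by auto
  then show ?thesis
    unfolding nonzero_spectrum_def spectrum_def
    using eigenvalue_root_char_poly[OF assms] by (auto simp: order_root)
qed

text \<open>Over the complex numbers the characteristic polynomial splits into linear
  factors.\<close>

lemma jordan_nf_exists_complex:
  fixes M :: "complex mat"
  assumes "M \<in> carrier_mat n n"
  shows "\<exists>js. jordan_nf M js"
  using char_poly_factorized[OF assms] jordan_nf_exists[OF assms] by blast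

definition rect_matrix :: "'a list \<Rightarrow> 'b list \<Rightarrow> ('a \<Rightarrow> 'b \<Rightarrow> real) \<Rightarrow> complex mat" where
  "rect_matrix xs ys k =
     mat (length xs) (length ys) (\<lambda>(i, j). complex_of_real (k (xs ! i) (ys ! j)))"

text \<open>The enumeration \<open>ys\<close> is a bijection from positions to \<open>S\<close>, so
  the sum over \<open>S\<close> is the sum over positions in the matrix product.\<close>

lemma kernel_matrix_eq_rect_matrix_mult:
  assumes "distinct ys" and "set ys = S"
    and "\<And>x z. x \<in> set xs \<Longrightarrow> z \<in> set xs \<Longrightarrow> k x z = (\<Sum>y\<in>S. a x y * b y z)"
  shows "kernel_matrix xs k = rect_matrix xs ys a * rect_matrix ys xs b"
proof (rule eq_matI)
  fix i j
  assume "i < dim_row (rect_matrix xs ys a * rect_matrix ys xs b)"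
    and "j < dim_col (rect_matrix xs ys a * rect_matrix ys xs b)"
  then have i: "i < length xs" and j: "j < length xs"
    unfolding rect_matrix_def by auto
  have "(\<Sum>y\<in>S. a (xs ! i) y * b y (xs ! j)) =
      (\<Sum>l<length ys. a (xs ! i) (ys ! l) * b (ys ! l) (xs ! j))"
    using sum.reindex_bij_betw[OF bij_betw_nth[OF assms(1) refl assms(2)[symmetric]],
        of "\<lambda>y. a (xs ! i) y * b y (xs ! j)"] by simp
  then show "kernel_matrix xs k $$ (i, j) =
      (rect_matrix xs ys a * rect_matrix ys xs b) $$ (i, j)"
    unfolding kernel_matrix_def rect_matrix_def using i j assms(3)[of "xs ! i" "xs ! j"]
    by (simp add: scalar_prod_def lessThan_atLeast0)
qed (auto simp: kernel_matrix_def rect_matrix_def)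

theorem theorem3p7:
  fixes G :: "('g, 'm) monoid_scheme"
    and X :: "'x set"
    and \<phi> :: "'g \<Rightarrow> 'x \<Rightarrow> 'x"
    and xs :: "'x list"
    and gs :: "'g list"
    and K Q :: "complex mat"
  assumes "group_action G X \<phi>"
    and "finite (carrier G)"
    and "finite X"
    and "X \<noteq> {}"
    and "distinct xs" and "set xs = X"
    and "distinct gs" and "set gs = fixing_elements G X \<phi>"
  defines "K \<equiv> kernel_matrix xs (burnside_kernel G X \<phi>)"
    and "Q \<equiv> kernel_matrix gs (dual_burnside_kernel G X \<phi>)"
  shows "nonzero_spectrum K = nonzero_spectrum Q
    \<and> (\<forall>z \<in> nonzero_spectrum K.
         Polynomial.order z (char_poly K) = Polynomial.order z (char_poly Q))
    \<and> (\<exists>js. jordan_nf K js) \<and> (\<exists>js. jordan_nf Q js)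
    \<and> (\<forall>js js'. jordan_nf K js \<longrightarrow> jordan_nf Q js' \<longrightarrow>
         nonsingular_blocks js = nonsingular_blocks js')"
  proof -
  define m n where "m = length xs" and "n = length gs"
  \<comment> \<open>Row \<open>x\<close> of \<open>A\<close> is the uniform distribution on the
    stabilizer of \<open>x\<close>, and row \<open>g\<close> of \<open>B\<close> the uniform
    distribution on the fixed points of \<open>g\<close>: the two half-steps of the Burnside
    process.\<close>
  define A where "A = rect_matrix xs gs (\<lambda>x g.
    if g \<in> stabilizer G \<phi> x then 1 / real (card (stabilizer G \<phi> x)) else 0)"
  define B where "B = rect_matrix gs xs (\<lambda>g x.
    if x \<in> invariants X \<phi> g then 1 / real (card (invariants X \<phi> g)) else 0)"
  have A: "A \<in> carrier_mat m n" and B: "B \<in> carrier_mat n m"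
    unfolding A_def B_def rect_matrix_def m_def n_def by auto
  have fin: "finite (fixing_elements G X \<phi>)"
    using assms(8) by (metis finite_set)
  have KAB: "K = A * B"
    unfolding K_def A_def B_def
  proof (rule kernel_matrix_eq_rect_matrix_mult[OF assms(7,8)])
    fix x y
    assume "x \<in> set xs" "y \<in> set xs"
    \<comment> \<open>The product of the two entries is nonzero only on this set. Summing over
      \<open>fixing_elements\<close> loses nothing, since any \<open>g\<close> that stabilizes
      \<open>x\<close> has the fixed point \<open>x\<close>.\<close>
    then have "fixing_elements G X \<phi> \<inter> {g. g \<in> stabilizer G \<phi> x \<and> y \<in> invariants X \<phi> g} =
        stabilizer G \<phi> x \<inter> stabilizer G \<phi> y"
      using assms(6) unfolding fixing_elements_def stabilizer_def invariants_def by auto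
    then show "burnside_kernel G X \<phi> x y = (\<Sum>g\<in>fixing_elements G X \<phi>.
        (if g \<in> stabilizer G \<phi> x then 1 / real (card (stabilizer G \<phi> x)) else 0) *
        (if y \<in> invariants X \<phi> g then 1 / real (card (invariants X \<phi> g)) else 0))"
      unfolding burnside_kernel_def sum_distrib_left
      by (intro sum.mono_neutral_cong_left[OF fin]) auto
  qed
  have QBA: "Q = B * A"
    unfolding Q_def A_def B_def
  proof (rule kernel_matrix_eq_rect_matrix_mult[OF assms(5,6)])
    fix g h
    assume "g \<in> set gs" "h \<in> set gs"
    then have "X \<inter> {x. x \<in> invariants X \<phi> g \<and> h \<in> stabilizer G \<phi> x} =
        invariants X \<phi> g \<inter> invariants X \<phi> h"
      using assms(8) unfolding fixing_elements_def stabilizer_def invariants_def by auto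
    then show "dual_burnside_kernel G X \<phi> g h = (\<Sum>x\<in>X.
        (if x \<in> invariants X \<phi> g then 1 / real (card (invariants X \<phi> g)) else 0) *
        (if h \<in> stabilizer G \<phi> x then 1 / real (card (stabilizer G \<phi> x)) else 0))"
      unfolding dual_burnside_kernel_def sum_distrib_left
      by (intro sum.mono_neutral_cong_left[OF assms(3)]) auto
  qed
  have K: "K \<in> carrier_mat m m" and Q: "Q \<in> carrier_mat n n"
    unfolding KAB QBA using A B by auto
  have blocks: "nonsingular_blocks js = nonsingular_blocks js'"
    if "jordan_nf K js" "jordan_nf Q js'" for js js'
    using that dim_gen_eigenspace_mult_commute[OF A B]
    unfolding KAB QBA by (rule nonsingular_blocks_eq_if_dim_gen_eigenspace_eq)
  \<comment> \<open>One Jordan form of each matrix suffices to read off the multiplicities, and from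
    these the spectra.\<close>
  obtain js js' where js: "jordan_nf K js" "jordan_nf Q js'"
    using jordan_nf_exists_complex K Q by blast
  have order: "Polynomial.order e (char_poly K) = Polynomial.order e (char_poly Q)"
    if "e \<noteq> 0" for e
    using jordan_nf_order_nonsingular_blocks[OF _ that] js blocks[OF js] by simp
  have "nonzero_spectrum K = nonzero_spectrum Q"
    using order nonzero_spectrum_iff_order[OF K] nonzero_spectrum_iff_order[OF Q] by auto
  moreover have "\<forall>z\<in>nonzero_spectrum K.
      Polynomial.order z (char_poly K) = Polynomial.order z (char_poly Q)"
    using order unfolding nonzero_spectrum_def by blast
  ultimately show ?thesis using js blocks by blast
qed

end
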